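(* Let $F:\Omega\times I\to\Omega\times I$, $F(\omega,x)=(\tau(\omega),f_\omega(x))$, be a skew product, where $\tau:\Omega\to\Omega$ is an ergodic measure-preserving transformation of a standard probability space $(\Omega,\mathscr F,\mathbb P)$ and the fiber maps $f_\omega:I\to I$ are measurable. Assume that (i) the measure $\mathbb P\times\mathrm{Leb}$ is ergodic with respect to $F$, and (ii) $F$ satisfies the skew-product fluctuation law with $\gamma_0<\gamma_1$. Then $$\liminf_{n\to\infty}\frac1n\sum_{j=0}^{n-1}f^j_\omega(x)\le\gamma_0<\gamma_1\le\limsup_{n\to\infty}\frac1n\sum_{j=0}^{n-1}f^j_\omega(x)\quad\text{for }(\mathbb P\times\mathrm{Leb})\text{-a.e. }(\omega,x)\in\Omega\times I.$$ In particular, $F$ exhibits historical behavior for $(\mathbb P\times\mathrm{Leb})$-almost every point.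
   Context: $I=[0,1]$ with Lebesgue measure $\mathrm{Leb}$. $f^0_\omega=\mathrm{id}$ and $f^n_\omega=f_{\tau^{n-1}(\omega)}\circ\dots\circ f_{\tau(\omega)}\circ f_\omega$ for $n\ge1$. Ergodicity of the (not necessarily $F$-invariant) probability $\mu=\mathbb P\times\mathrm{Leb}$ with respect to $F$: $\mu(A)\in\{0,1\}$ for every measurable set $A$ such that $F(A)\subset A$. Skew-product fluctuation law with constants $\gamma_0,\gamma_1\in(0,1)$: $$\liminf_{n\to\infty}(\mathbb P\times\mathrm{Leb})\Big(\frac1n\sum_{j=0}^{n-1}\mathbf 1_{I_i(\gamma_i)}(f^j_\omega(x))\le\alpha\Big)<1\quad\text{for every }\alpha\in(0,1)\text{ and }i=0,1,$$ where $I_0(\gamma)=[0,\gamma]$ and $I_1(\gamma)=[\gamma,1]$. Historical behavior for $(\mathbb P\times\mathrm{Leb})$-a.e. point: for $(\mathbb P\times\mathrm{Leb})$-a.e. $(\omega,x)$ there is a continuous function $\varphi:I\to\mathbb R$ such that $\lim_{n\to\infty}\frac1n\sum_{j=0}^{n-1}\varphi(f^j_\omega(x))$ does not exist. *)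

theory Defs
  imports "HOL-Probability.Probability"
begin

text \<open>
  A probability space is standard if, up to completion and null sets, it is a Polish space
  with a Borel probability measure. Both usual conventions are instances: a standard Borel
  space with a probability measure (take \<open>T\<close> a Polish topology generating the
  \<open>\<sigma>\<close>-algebra), and a complete Lebesgue--Rokhlin space.
\<close>

definition standard_prob_space :: "'w measure \<Rightarrow> bool" where
  "standard_prob_space M \<longleftrightarrow> prob_space M \<and>
     (\<exists>T. completely_metrizable_space T \<and> second_countable T \<and>
          topspace T \<subseteq> space M \<and>
          space M - topspace T \<in> null_sets (completion M) \<and>
          sets (restrict_space (completion M) (topspace T)) =
          sets (completion (measure_of (topspace T) {U. openin T U} (emeasure (completion M)))))"

definition measure_preserving_map :: "'w measure \<Rightarrow> ('w \<Rightarrow> 'w) \<Rightarrow> bool" where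
  "measure_preserving_map M \<tau> \<longleftrightarrow>
     \<tau> \<in> measurable M M \<and> (\<forall>A\<in>sets M. emeasure M (\<tau> -` A \<inter> space M) = emeasure M A)"

definition ergodic_mpt :: "'w measure \<Rightarrow> ('w \<Rightarrow> 'w) \<Rightarrow> bool" where
  "ergodic_mpt M \<tau> \<longleftrightarrow> measure_preserving_map M \<tau> \<and>
     (\<forall>A\<in>sets M. \<tau> -` A \<inter> space M = A \<longrightarrow> emeasure M A = 0 \<or> emeasure M A = 1)"

text \<open>
  Ergodicity of a probability measure that need not be invariant under the map: the sets
  considered are the forward invariant ones.
\<close>

definition ergodic_forward :: "'a measure \<Rightarrow> ('a \<Rightarrow> 'a) \<Rightarrow> bool" where
  "ergodic_forward M F \<longleftrightarrow>
     (\<forall>A\<in>sets M. F ` A \<subseteq> A \<longrightarrow> emeasure M A = 0 \<or> emeasure M A = 1)"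

definition leb_unit :: "real measure" where
  "leb_unit = restrict_space lborel {0..1}"

definition skew :: "('w \<Rightarrow> 'w) \<Rightarrow> ('w \<Rightarrow> real \<Rightarrow> real) \<Rightarrow> 'w \<times> real \<Rightarrow> 'w \<times> real" where
  "skew \<tau> f = (\<lambda>(\<omega>, x). (\<tau> \<omega>, f \<omega> x))"

text \<open>
  Joint measurability of the skew product is part of the notion: measurability of every
  fiber map alone would not make the orbit averages measurable on the product.
\<close>

definition measurable_skew_product ::
    "'w measure \<Rightarrow> ('w \<Rightarrow> 'w) \<Rightarrow> ('w \<Rightarrow> real \<Rightarrow> real) \<Rightarrow> bool" where
  "measurable_skew_product M \<tau> f \<longleftrightarrow>
     (\<forall>\<omega>\<in>space M. f \<omega> \<in> measurable leb_unit leb_unit) \<and>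
     skew \<tau> f \<in> measurable (M \<Otimes>\<^sub>M leb_unit) (M \<Otimes>\<^sub>M leb_unit)"

primrec fiber_iter ::
    "('w \<Rightarrow> 'w) \<Rightarrow> ('w \<Rightarrow> real \<Rightarrow> real) \<Rightarrow> nat \<Rightarrow> 'w \<Rightarrow> real \<Rightarrow> real" where
  "fiber_iter \<tau> f 0 \<omega> = id"
| "fiber_iter \<tau> f (Suc n) \<omega> = f ((\<tau> ^^ n) \<omega>) \<circ> fiber_iter \<tau> f n \<omega>"

definition fiber_average ::
    "('w \<Rightarrow> 'w) \<Rightarrow> ('w \<Rightarrow> real \<Rightarrow> real) \<Rightarrow> (real \<Rightarrow> real) \<Rightarrow> nat \<Rightarrow> 'w \<Rightarrow> real \<Rightarrow> real" where
  "fiber_average \<tau> f \<phi> n \<omega> x = (1 / real n) * (\<Sum>j<n. \<phi> (fiber_iter \<tau> f j \<omega> x))"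

definition fluctuation_law ::
    "'w measure \<Rightarrow> ('w \<Rightarrow> 'w) \<Rightarrow> ('w \<Rightarrow> real \<Rightarrow> real) \<Rightarrow> real \<Rightarrow> real \<Rightarrow> bool" where
  "fluctuation_law M \<tau> f \<gamma>\<^sub>0 \<gamma>\<^sub>1 \<longleftrightarrow>
     \<gamma>\<^sub>0 \<in> {0<..<1} \<and> \<gamma>\<^sub>1 \<in> {0<..<1} \<and>
     (\<forall>\<alpha>\<in>{0<..<1}. \<forall>J\<in>{{0..\<gamma>\<^sub>0}, {\<gamma>\<^sub>1..1}}.
        liminf (\<lambda>n. emeasure (M \<Otimes>\<^sub>M leb_unit)
          {(\<omega>, x) \<in> space (M \<Otimes>\<^sub>M leb_unit). fiber_average \<tau> f (indicator J) n \<omega> x \<le> \<alpha>}) < 1)"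

definition historical_point ::
    "('w \<Rightarrow> 'w) \<Rightarrow> ('w \<Rightarrow> real \<Rightarrow> real) \<Rightarrow> 'w \<Rightarrow> real \<Rightarrow> bool" where
  "historical_point \<tau> f \<omega> x \<longleftrightarrow>
     (\<exists>\<phi> :: real \<Rightarrow> real. continuous_on {0..1} \<phi> \<and>
        \<not> convergent (\<lambda>n. fiber_average \<tau> f \<phi> n \<omega> x))"

end

theory Submission
  imports Defs
begin

text \<open>
  Fix one of the two end intervals \<open>J\<close> and let \<open>a\<^sub>n(z)\<close> be the fraction of the first \<open>n\<close> points of the
  orbit of \<open>z\<close> whose fibre coordinate lies in \<open>J\<close>. If \<open>a\<^sub>n \<le> \<alpha>\<close> held eventually at almost every point, the
  events \<open>a\<^sub>n \<le> \<alpha>\<close> would have measure tending to \<open>1\<close>, against the fluctuation law; so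
  \<open>limsup a\<^sub>n \<ge> \<alpha>\<close> on a set of positive measure. Replacing \<open>z\<close> by its image changes \<open>a\<^sub>n(z)\<close> by at most
  \<open>1/n\<close>, hence this set is forward invariant, and ergodicity gives it full measure. Letting
  \<open>\<alpha>\<close> tend to \<open>1\<close> along a sequence yields \<open>limsup a\<^sub>n \<ge> 1\<close> almost everywhere
  (\<open>ergodic_forward_limsup_average_ge_1\<close>): along suitable times almost the whole orbit lies in \<open>J\<close>.

  Along such times for \<open>J = [\<gamma>\<^sub>1, 1]\<close> the average position is asymptotically at least \<open>\<gamma>\<^sub>1\<close>, because a
  point of the unit interval is at least \<open>\<gamma>\<^sub>1\<close> times the indicator of \<open>J\<close>; the case of \<open>[0, \<gamma>\<^sub>0]\<close> is
  the same argument for the distance to the right end point. Both happen at almost every point, so the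
  averages of the continuous function \<open>\<lambda>y. y\<close> oscillate there.
\<close>

section \<open>Birkhoff averages along a forward ergodic map\<close>

definition birkhoff_average :: "('a \<Rightarrow> 'a) \<Rightarrow> ('a \<Rightarrow> real) \<Rightarrow> nat \<Rightarrow> 'a \<Rightarrow> real" where
  "birkhoff_average F g n z = (1 / real n) * (\<Sum>j<n. g ((F ^^ j) z))"

lemma funpow_in_space:
  assumes "F \<in> measurable M M" "z \<in> space M"
  shows "(F ^^ n) z \<in> space M"
  using assms by (induction n) (auto dest: measurable_space)

lemma measurable_birkhoff_average [measurable]:
  assumes [measurable]: "F \<in> measurable M M" "g \<in> borel_measurable M"
  shows "birkhoff_average F g n \<in> borel_measurable M"
  unfolding birkhoff_average_def by measurable

lemma birkhoff_average_image:
  "birkhoff_average F g n (F z) =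
    (g ((F ^^ n) z) - g z) / real n + birkhoff_average F g n z"
proof -
  have "(\<Sum>j<n. g ((F ^^ j) (F z))) = (\<Sum>j<n. g ((F ^^ Suc j) z))"
    by (simp add: funpow_swap1)
  also have "\<dots> = (\<Sum>j<Suc n. g ((F ^^ j) z)) - g z"
    by (subst sum.lessThan_Suc_shift) simp
  finally show ?thesis
    unfolding birkhoff_average_def by (simp add: add_divide_distrib diff_divide_distrib)
qed

text \<open>
  The two averages differ by a boundary term of order \<open>1/n\<close>; boundedness of the observable is what
  makes it vanish.
\<close>

lemma limsup_birkhoff_average_image:
  assumes F: "F \<in> measurable M M" and z: "z \<in> space M"
    and bounded: "\<And>y. y \<in> space M \<Longrightarrow> \<bar>g y\<bar> \<le> C"
  shows "limsup (\<lambda>n. ereal (birkhoff_average F g n (F z))) =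
         limsup (\<lambda>n. ereal (birkhoff_average F g n z))"
proof -
  have "(\<lambda>n. (g ((F ^^ n) z) - g z) / real n) \<longlonglongrightarrow> 0"
  proof (rule tendsto_0_le[where K = 1])
    show "(\<lambda>n. 2 * C / real n) \<longlonglongrightarrow> 0"
      by (intro tendsto_divide_0[OF tendsto_const] filterlim_at_top_imp_at_infinity
            filterlim_real_sequentially)
    show "\<forall>\<^sub>F n in sequentially. norm ((g ((F ^^ n) z) - g z) / real n)
            \<le> norm (2 * C / real n) * 1"
    proof (rule always_eventually, rule allI)
      fix n
      have "\<bar>g ((F ^^ n) z) - g z\<bar> \<le> 2 * C"
        using bounded[OF funpow_in_space[OF F z, of n]] bounded[OF z] by linarith
      then show "norm ((g ((F ^^ n) z) - g z) / real n) \<le> norm (2 * C / real n) * 1"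
        by (auto simp: abs_divide intro!: divide_right_mono)
    qed
  qed
  then have "(\<lambda>n. ereal ((g ((F ^^ n) z) - g z) / real n)) \<longlonglongrightarrow> 0"
    by (simp add: zero_ereal_def)
  from ereal_limsup_lim_add[OF this, of "\<lambda>n. ereal (birkhoff_average F g n z)"]
  show ?thesis
    by (simp add: birkhoff_average_image)
qed

text \<open>
  Otherwise the increasing sets \<open>\<Inter>n\<ge>N. {u n \<le> a}\<close> would exhaust the space up to a null
  set, and continuity from below would make the measure of \<open>{u N \<le> a}\<close> tend to \<open>1\<close>.
\<close>

lemma (in prob_space) limsup_ge_not_null:
  fixes u :: "nat \<Rightarrow> 'a \<Rightarrow> real"
  assumes [measurable]: "\<And>n. u n \<in> borel_measurable M"
    and "liminf (\<lambda>n. emeasure M {z \<in> space M. u n z \<le> a}) < 1"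
  shows "emeasure M {z \<in> space M. ereal a \<le> limsup (\<lambda>n. ereal (u n z))} \<noteq> 0"
proof
  assume null: "emeasure M {z \<in> space M. ereal a \<le> limsup (\<lambda>n. ereal (u n z))} = 0"
  define V where "V N = {z \<in> space M. \<forall>n\<ge>N. u n z \<le> a}" for N
  have V [measurable]: "V N \<in> sets M" for N
    unfolding V_def by measurable
  have "AE z in M. \<not> ereal a \<le> limsup (\<lambda>n. ereal (u n z))"
    by (rule AE_I[where N = "{z \<in> space M. ereal a \<le> limsup (\<lambda>n. ereal (u n z))}"])
       (use null in auto)
  moreover have "AE z in M. z \<in> space M"
    by simp
  ultimately have "AE z in M. z \<in> (\<Union>N. V N)"
  proof eventually_elim
    case (elim z)
    then have "\<forall>\<^sub>F n in sequentially. ereal (u n z) < ereal a"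
      by (intro Limsup_lessD) (auto simp: not_le)
    then obtain N where "\<And>n. n \<ge> N \<Longrightarrow> u n z < a"
      by (auto simp: eventually_sequentially)
    then show ?case
      using elim unfolding V_def by (force intro: less_imp_le)
  qed
  then have "emeasure M (\<Union>N. V N) = 1"
    by (intro emeasure_eq_1_AE) auto
  moreover have "(\<lambda>N. emeasure M (V N)) \<longlonglongrightarrow> emeasure M (\<Union>N. V N)"
    by (rule Lim_emeasure_incseq) (auto simp: incseq_def V_def)
  ultimately have "1 = liminf (\<lambda>N. emeasure M (V N))"
    using lim_imp_Liminf[of sequentially "\<lambda>N. emeasure M (V N)" 1] by simp
  also have "\<dots> \<le> liminf (\<lambda>n. emeasure M {z \<in> space M. u n z \<le> a})"
    by (intro Liminf_mono always_eventually allI emeasure_mono) (auto simp: V_def)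
  finally show False
    using assms(2) by simp
qed

text \<open>
  The set where the upper limit is at least \<open>a\<close> is not null by the fluctuation hypothesis and is mapped
  into itself because the upper limit is constant along orbits; the zero-one alternative for forward
  invariant sets leaves only full measure.
\<close>

lemma (in prob_space) ergodic_forward_limsup_average_ge:
  assumes erg: "ergodic_forward M F"
    and F [measurable]: "F \<in> measurable M M" and [measurable]: "g \<in> borel_measurable M"
    and bounded: "\<And>y. y \<in> space M \<Longrightarrow> \<bar>g y\<bar> \<le> C"
    and fluct: "liminf (\<lambda>n. emeasure M {z \<in> space M. birkhoff_average F g n z \<le> a}) < 1"
  shows "AE z in M. ereal a \<le> limsup (\<lambda>n. ereal (birkhoff_average F g n z))"
proof -
  define B where
    "B = {z \<in> space M. ereal a \<le> limsup (\<lambda>n. ereal (birkhoff_average F g n z))}"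
  have B: "B \<in> sets M"
    unfolding B_def by measurable
  have "F ` B \<subseteq> B"
    unfolding B_def
    using measurable_space[OF F] limsup_birkhoff_average_image[OF F _ bounded] by auto
  moreover have "emeasure M B \<noteq> 0"
    unfolding B_def by (rule limsup_ge_not_null[OF _ fluct]) measurable
  ultimately have "emeasure M B = 1"
    using erg B unfolding ergodic_forward_def by blast
  then have "AE z in M. z \<in> B"
    using B by (simp add: AE_in_set_eq_1 measure_def)
  then show ?thesis
    by (rule eventually_mono) (simp add: B_def)
qed

lemma (in prob_space) ergodic_forward_limsup_average_ge_1:
  assumes "ergodic_forward M F"
    and "F \<in> measurable M M" "g \<in> borel_measurable M"
    and "\<And>y. y \<in> space M \<Longrightarrow> \<bar>g y\<bar> \<le> C"
    and fluct: "\<And>a. a \<in> {0<..<1} \<Longrightarrow>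
      liminf (\<lambda>n. emeasure M {z \<in> space M. birkhoff_average F g n z \<le> a}) < 1"
  shows "AE z in M. 1 \<le> limsup (\<lambda>n. ereal (birkhoff_average F g n z))"
proof -
  define a :: "nat \<Rightarrow> real" where "a k = 1 - 1 / (real k + 2)" for k
  have a: "a k \<in> {0<..<1}" for k
    unfolding a_def by (auto simp: field_simps)
  have "a \<longlonglongrightarrow> 1"
    unfolding a_def by real_asymp
  then have lim: "(\<lambda>k. ereal (a k)) \<longlonglongrightarrow> 1"
    by (simp add: one_ereal_def)
  have "AE z in M. \<forall>k. ereal (a k) \<le> limsup (\<lambda>n. ereal (birkhoff_average F g n z))"
    unfolding AE_all_countable
    using ergodic_forward_limsup_average_ge[OF assms(1-4) fluct[OF a]] by blast
  then show ?thesis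
    by (rule eventually_mono) (auto intro: LIMSEQ_le_const2[OF lim])
qed

section \<open>Comparison of upper and lower limits\<close>

lemma limsup_ge_of_scaled_le:
  fixes u v :: "nat \<Rightarrow> real"
  assumes "1 \<le> limsup (\<lambda>n. ereal (u n))" "0 \<le> c"
    and "\<And>n. n > 0 \<Longrightarrow> c * u n \<le> v n"
  shows "ereal c \<le> limsup (\<lambda>n. ereal (v n))"
proof -
  have "ereal c \<le> ereal c * limsup (\<lambda>n. ereal (u n))"
    using ereal_mult_left_mono[OF assms(1), of "ereal c"] assms(2) by simp
  also have "\<dots> = limsup (\<lambda>n. ereal c * ereal (u n))"
    using Limsup_ereal_mult_left[OF sequentially_bot assms(2)] by (rule sym)
  also have "\<dots> \<le> limsup (\<lambda>n. ereal (v n))"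
    using assms(3) by (intro Limsup_mono eventually_sequentiallyI[of 1]) auto
  finally show ?thesis .
qed

lemma liminf_le_of_limsup_complement_ge:
  fixes v :: "nat \<Rightarrow> real"
  assumes "ereal (1 - c) \<le> limsup (\<lambda>n. ereal (1 - v n))"
  shows "liminf (\<lambda>n. ereal (v n)) \<le> ereal c"
proof -
  have "limsup (\<lambda>n. ereal (1 - v n)) = limsup (\<lambda>n. ereal 1 + - ereal (v n))"
    by simp
  also have "\<dots> = 1 - liminf (\<lambda>n. ereal (v n))"
    unfolding ereal_limsup_lim_add[OF tendsto_const, of "ereal 1", simplified] ereal_Limsup_uminus
    by (simp add: minus_ereal_def one_ereal_def)
  finally show ?thesis
    using assms by (cases "liminf (\<lambda>n. ereal (v n))") (auto simp: one_ereal_def)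
qed

section \<open>Fibre averages of a skew product\<close>

lemma funpow_skew: "(skew \<tau> f ^^ n) (\<omega>, x) = ((\<tau> ^^ n) \<omega>, fiber_iter \<tau> f n \<omega> x)"
  by (induction n) (auto simp: skew_def)

lemma birkhoff_average_skew:
  "birkhoff_average (skew \<tau> f) (\<lambda>z. \<phi> (snd z)) n (\<omega>, x) = fiber_average \<tau> f \<phi> n \<omega> x"
  by (simp add: birkhoff_average_def fiber_average_def funpow_skew)

lemma prob_space_leb_unit: "prob_space leb_unit"
  unfolding leb_unit_def by (rule prob_spaceI) (simp add: space_restrict_space emeasure_restrict_space)

lemma space_leb_unit: "space leb_unit = {0..1}"
  by (simp add: leb_unit_def space_restrict_space)

lemma fiber_iter_in_unit:
  assumes "skew \<tau> f \<in> measurable (P \<Otimes>\<^sub>M leb_unit) (P \<Otimes>\<^sub>M leb_unit)"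
    and "(\<omega>, x) \<in> space (P \<Otimes>\<^sub>M leb_unit)"
  shows "fiber_iter \<tau> f n \<omega> x \<in> {0..1}"
  using funpow_in_space[OF assms, of n]
  by (auto simp: funpow_skew space_pair_measure space_leb_unit)

lemma fiber_average_mono:
  assumes "\<And>j. \<phi> (fiber_iter \<tau> f j \<omega> x) \<le> \<psi> (fiber_iter \<tau> f j \<omega> x)"
  shows "fiber_average \<tau> f \<phi> n \<omega> x \<le> fiber_average \<tau> f \<psi> n \<omega> x"
  unfolding fiber_average_def by (intro mult_left_mono sum_mono assms) simp

lemma fiber_average_cmult:
  "fiber_average \<tau> f (\<lambda>y. c * \<phi> y) n \<omega> x = c * fiber_average \<tau> f \<phi> n \<omega> x"
  by (simp add: fiber_average_def sum_distrib_left algebra_simps)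

lemma fiber_average_complement:
  "n > 0 \<Longrightarrow> fiber_average \<tau> f (\<lambda>y. 1 - \<phi> y) n \<omega> x = 1 - fiber_average \<tau> f \<phi> n \<omega> x"
  by (simp add: fiber_average_def sum_subtractf field_simps)

lemma historical_point_of_liminf_less_limsup:
  assumes "continuous_on {0..1} \<phi>"
    and "liminf (\<lambda>n. ereal (fiber_average \<tau> f \<phi> n \<omega> x))
         < limsup (\<lambda>n. ereal (fiber_average \<tau> f \<phi> n \<omega> x))"
  shows "historical_point \<tau> f \<omega> x"
proof -
  have "\<not> convergent (\<lambda>n. fiber_average \<tau> f \<phi> n \<omega> x)"
  proof
    assume "convergent (\<lambda>n. fiber_average \<tau> f \<phi> n \<omega> x)"
    then obtain L where "(\<lambda>n. fiber_average \<tau> f \<phi> n \<omega> x) \<longlonglongrightarrow> L"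
      by (auto simp: convergent_def)
    then have "(\<lambda>n. ereal (fiber_average \<tau> f \<phi> n \<omega> x)) \<longlonglongrightarrow> ereal L"
      by simp
    from lim_imp_Liminf[OF _ this] lim_imp_Limsup[OF _ this] assms(2) show False
      by simp
  qed
  then show ?thesis
    unfolding historical_point_def using assms(1) by blast
qed

text \<open>
  Visits to \<open>J\<close> are averages of the observable \<open>(\<omega>, x) \<mapsto> indicator J x\<close> under the skew product, so the
  ergodic argument applies on the product space.
\<close>

lemma AE_limsup_visits_ge_1:
  assumes "prob_space P"
    and F: "skew \<tau> f \<in> measurable (P \<Otimes>\<^sub>M leb_unit) (P \<Otimes>\<^sub>M leb_unit)"
    and erg: "ergodic_forward (P \<Otimes>\<^sub>M leb_unit) (skew \<tau> f)"
    and law: "fluctuation_law P \<tau> f \<gamma>\<^sub>0 \<gamma>\<^sub>1"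
    and J: "J \<in> {{0..\<gamma>\<^sub>0}, {\<gamma>\<^sub>1..1}}"
  shows "AE (\<omega>, x) in P \<Otimes>\<^sub>M leb_unit.
           1 \<le> limsup (\<lambda>n. ereal (fiber_average \<tau> f (indicator J) n \<omega> x))"
proof -
  interpret \<Omega>: prob_space P by fact
  interpret L: prob_space leb_unit by (rule prob_space_leb_unit)
  interpret pair_prob_space P leb_unit ..
  let ?g = "\<lambda>z. indicator J (snd z) :: real"
  have "J \<in> sets borel"
    using J by auto
  then have "(indicator J :: real \<Rightarrow> real) \<in> borel_measurable leb_unit"
    unfolding leb_unit_def by (intro measurable_restrict_space1) simp
  then have g: "?g \<in> borel_measurable (P \<Otimes>\<^sub>M leb_unit)"
    by measurable
  have "liminf (\<lambda>n. emeasure (P \<Otimes>\<^sub>M leb_unit)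
          {z \<in> space (P \<Otimes>\<^sub>M leb_unit). birkhoff_average (skew \<tau> f) ?g n z \<le> a}) < 1"
    if "a \<in> {0<..<1}" for a
  proof -
    have "{z \<in> space (P \<Otimes>\<^sub>M leb_unit). birkhoff_average (skew \<tau> f) ?g n z \<le> a} =
          {(\<omega>, x) \<in> space (P \<Otimes>\<^sub>M leb_unit). fiber_average \<tau> f (indicator J) n \<omega> x \<le> a}" for n
      by (auto simp: birkhoff_average_skew)
    then show ?thesis
      using law J that unfolding fluctuation_law_def by auto
  qed
  from ergodic_forward_limsup_average_ge_1[OF erg F g, of 1, OF _ this]
  have "AE z in P \<Otimes>\<^sub>M leb_unit. 1 \<le> limsup (\<lambda>n. ereal (birkhoff_average (skew \<tau> f) ?g n z))"
    by (simp add: indicator_def)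
  then show ?thesis
    by (rule eventually_mono) (auto simp: birkhoff_average_skew)
qed

section \<open>Oscillation of the averages\<close>

theorem theorem2:
  fixes P :: "'w measure"
    and \<tau> :: "'w \<Rightarrow> 'w"
    and f :: "'w \<Rightarrow> real \<Rightarrow> real"
    and \<gamma>\<^sub>0 \<gamma>\<^sub>1 :: real
  assumes "standard_prob_space P"
    and "ergodic_mpt P \<tau>"
    and "measurable_skew_product P \<tau> f"
    and "ergodic_forward (P \<Otimes>\<^sub>M leb_unit) (skew \<tau> f)"
    and "fluctuation_law P \<tau> f \<gamma>\<^sub>0 \<gamma>\<^sub>1"
    and "\<gamma>\<^sub>0 < \<gamma>\<^sub>1"
  shows "(AE (\<omega>, x) in P \<Otimes>\<^sub>M leb_unit.
            liminf (\<lambda>n. ereal (fiber_average \<tau> f (\<lambda>y. y) n \<omega> x)) \<le> ereal \<gamma>\<^sub>0 \<and>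
            \<gamma>\<^sub>0 < \<gamma>\<^sub>1 \<and>
            ereal \<gamma>\<^sub>1 \<le> limsup (\<lambda>n. ereal (fiber_average \<tau> f (\<lambda>y. y) n \<omega> x))) \<and>
         (AE (\<omega>, x) in P \<Otimes>\<^sub>M leb_unit. historical_point \<tau> f \<omega> x)"
proof -
  let ?M = "P \<Otimes>\<^sub>M leb_unit"
  have P: "prob_space P"
    using assms(1) by (simp add: standard_prob_space_def)
  have F: "skew \<tau> f \<in> measurable ?M ?M"
    using assms(3) by (simp add: measurable_skew_product_def)
  have \<gamma>: "0 < \<gamma>\<^sub>0" "\<gamma>\<^sub>0 < 1" "0 < \<gamma>\<^sub>1" "\<gamma>\<^sub>1 < 1"
    using assms(5) by (auto simp: fluctuation_law_def)
  note visits = AE_limsup_visits_ge_1[OF P F assms(4,5)]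
  have "AE (\<omega>, x) in ?M.
      liminf (\<lambda>n. ereal (fiber_average \<tau> f (\<lambda>y. y) n \<omega> x)) \<le> ereal \<gamma>\<^sub>0 \<and>
      ereal \<gamma>\<^sub>1 \<le> limsup (\<lambda>n. ereal (fiber_average \<tau> f (\<lambda>y. y) n \<omega> x))"
    using visits[of "{0..\<gamma>\<^sub>0}", simplified] visits[of "{\<gamma>\<^sub>1..1}", simplified] AE_space[of ?M]
  proof eventually_elim
    case (elim z)
    obtain \<omega> x where z: "z = (\<omega>, x)"
      by (cases z)
    have orbit: "fiber_iter \<tau> f j \<omega> x \<in> {0..1}" for j
      using fiber_iter_in_unit[OF F] elim(3) z by simp
    let ?b = "\<lambda>n. fiber_average \<tau> f (\<lambda>y. y) n \<omega> x"
    \<comment> \<open>A point in \<open>[0, \<gamma>\<^sub>0]\<close> has distance at least \<open>1 - \<gamma>\<^sub>0\<close> from \<open>1\<close>; elsewhere in the unit interval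
      the distance is still nonnegative.\<close>
    have "(1 - \<gamma>\<^sub>0) * fiber_average \<tau> f (indicator {0..\<gamma>\<^sub>0}) n \<omega> x \<le> 1 - ?b n" if "n > 0" for n
      unfolding fiber_average_complement[OF that, symmetric] fiber_average_cmult[symmetric]
      using orbit by (intro fiber_average_mono) (auto simp: indicator_def)
    then have "ereal (1 - \<gamma>\<^sub>0) \<le> limsup (\<lambda>n. ereal (1 - ?b n))"
      using elim(1) \<gamma> z by (intro limsup_ge_of_scaled_le) auto
    then have "liminf (\<lambda>n. ereal (?b n)) \<le> ereal \<gamma>\<^sub>0"
      by (rule liminf_le_of_limsup_complement_ge)
    moreover have "\<gamma>\<^sub>1 * fiber_average \<tau> f (indicator {\<gamma>\<^sub>1..1}) n \<omega> x \<le> ?b n" for n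
      unfolding fiber_average_cmult[symmetric]
      using orbit by (intro fiber_average_mono) (auto simp: indicator_def)
    then have "ereal \<gamma>\<^sub>1 \<le> limsup (\<lambda>n. ereal (?b n))"
      using elim(2) \<gamma> z by (intro limsup_ge_of_scaled_le) auto
    ultimately show ?case
      using z by simp
  qed
  moreover from this have "AE (\<omega>, x) in ?M. historical_point \<tau> f \<omega> x"
  proof eventually_elim
    case (elim z)
    obtain \<omega> x where z: "z = (\<omega>, x)"
      by (cases z)
    have "liminf (\<lambda>n. ereal (fiber_average \<tau> f (\<lambda>y. y) n \<omega> x))
        < limsup (\<lambda>n. ereal (fiber_average \<tau> f (\<lambda>y. y) n \<omega> x))"
      using elim z assms(6) by (auto intro: le_less_trans[OF _ less_le_trans[of _ "ereal \<gamma>\<^sub>1"]])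
    then show ?case
      using z historical_point_of_liminf_less_limsup[OF continuous_on_id] by simp
  qed
  ultimately show ?thesis
    using assms(6) by simp
qed

end
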